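(* Let $(G,\tau,\oplus)$ be a (Hausdorff) strongly topological gyrogroup with a symmetric neighborhood base $\mathscr U$ at $0$, and let $H$ be an admissible subgyrogroup of $G$ generated from $\mathscr U$. If $H$ is neutral and the quotient space $G/H$ is Fréchet-Urysohn and has an $\omega^{\omega}$-base, then $G/H$ is first-countable.
   Context: A groupoid is a nonempty set with a binary operation; $\mathrm{Aut}(G,\oplus)$ is the set of bijective maps $f:G\to G$ with $f(x\oplus y)=f(x)\oplus f(y)$. A gyrogroup is a groupoid $(G,\oplus)$ such that: (G1) there is a unique $0\in G$ with $0\oplus a=a=a\oplus 0$ for all $a\in G$; (G2) each $x\in G$ has a unique inverse $\ominus x\in G$ with $\ominus x\oplus x=0=x\oplus(\ominus x)$; (G3) for all $x,y\in G$ there is $\mathrm{gyr}[x,y]\in\mathrm{Aut}(G,\oplus)$ with $x\oplus(y\oplus z)=(x\oplus y)\oplus\mathrm{gyr}[x,y](z)$ for all $z\in G$; (G4) $\mathrm{gyr}[x\oplus y,y]=\mathrm{gyr}[x,y]$ for all $x,y\in G$. For $A,B\subset G$, $A\oplus B=\{a\oplus b:a\in A,b\in B\}$ and $\ominus A=\{\ominus a:a\in A\}$; $A$ is symmetric if $\ominus A=A$. A nonempty $H\subset G$ is a subgyrogroup if $\oplus$ restricts to a binary operation on $H$, for all $x,y\in H$ the restriction $\mathrm{gyr}[x,y]|_H:H\to\mathrm{gyr}[x,y](H)$ is a bijective homomorphism, and $(H,\oplus|_{H\times H})$ is a gyrogroup. It is an $L$-subgyrogroup if moreover $\mathrm{gyr}[a,h](H)=H$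 for all $a\in G$, $h\in H$. A topological gyrogroup is a gyrogroup with a topology $\tau$ such that $\oplus:G\times G\to G$ is jointly continuous and $x\mapsto\ominus x$ is continuous. It is a strongly topological gyrogroup with neighborhood base $\mathscr U$ at $0$ if $\mathscr U$ is a neighborhood base at $0$ with $\mathrm{gyr}[x,y](U)=U$ for all $U\in\mathscr U$ and $x,y\in G$; $\mathscr U$ is symmetric if every $U\in\mathscr U$ is symmetric. A subgyrogroup $H$ of $G$ is admissible if there is a sequence $\{U_n:n\in\omega\}$ of open symmetric neighborhoods of $0$ with $U_{n+1}\oplus(U_{n+1}\oplus U_{n+1})\subset U_n$ for all $n\in\omega$ and $H=\bigcap_{n\in\omega}U_n$; it is generated from $\mathscr U$ if such a sequence can be taken with each $U_n\in\mathscr U$. (Such an $H$ is known to be a closed $L$-subgyrogroup.) For an $L$-subgyrogroup $H$, $G/H=\{a\oplus H:a\in G\}$ is a partition of $G$; $\pi:G\to G/H$, $\pi(a)=a\oplus H$, and $G/H$ carries the quotient topology ($O$ is open iff $\pi^{-1}(O)$ is open in $G$). All topological spaces are assumed Hausdorff. An $L$-subgyrogroup $H$ of $G$ is neutral if for every open neighborhood $U$ of $0$ in $G$ there is an open neighborhood $V$ of $0$ with $H\oplus V\subset U\oplus H$. A space $X$ is Fréchet-Urysohn if for every $A\subset X$ and $x\in\overline A$ there is a sequence in $A$ converging to $x$. A space $X$ has an $\omega^{\omega}$-base if every $x\in X$ has a base of neighborhoods of the form $\{U_\alpha(x):\alpha\in\mathbb N^{\mathbb N}\}$ with $U_\beta(x)\subset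 U_\alpha(x)$ whenever $\alpha\le\beta$, where $\mathbb N^{\mathbb N}$ has the pointwise partial order ($\alpha\le\beta$ iff $\alpha(n)\le\beta(n)$ for all $n\in\mathbb N$). *)

theory Defs
  imports "HOL-Analysis.Analysis"
begin

section \<open>Gyrogroups\<close>

locale gyrogroup =
  fixes G :: "'a set"
    and add :: "'a \<Rightarrow> 'a \<Rightarrow> 'a"  (infixl "\<oplus>" 65)
    and zero :: 'a  ("\<zero>")
    and neg :: "'a \<Rightarrow> 'a"  ("\<ominus> _" [81] 80)
    and gyr :: "'a \<Rightarrow> 'a \<Rightarrow> 'a \<Rightarrow> 'a"
  assumes add_closed: "\<lbrakk>x \<in> G; y \<in> G\<rbrakk> \<Longrightarrow> x \<oplus> y \<in> G"
    and zero_closed: "\<zero> \<in> G"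
    and zero_left: "a \<in> G \<Longrightarrow> \<zero> \<oplus> a = a"
    and zero_right: "a \<in> G \<Longrightarrow> a \<oplus> \<zero> = a"
    and zero_unique: "\<lbrakk>e \<in> G; \<forall>a\<in>G. e \<oplus> a = a \<and> a \<oplus> e = a\<rbrakk> \<Longrightarrow> e = \<zero>"
    and neg_closed: "x \<in> G \<Longrightarrow> \<ominus> x \<in> G"
    and neg_left: "x \<in> G \<Longrightarrow> (\<ominus> x) \<oplus> x = \<zero>"
    and neg_right: "x \<in> G \<Longrightarrow> x \<oplus> (\<ominus> x) = \<zero>"
    and neg_unique: "\<lbrakk>x \<in> G; y \<in> G; y \<oplus> x = \<zero>; x \<oplus> y = \<zero>\<rbrakk> \<Longrightarrow> y = \<ominus> x"
    and gyr_bij: "\<lbrakk>x \<in> G; y \<in> G\<rbrakk> \<Longrightarrow> bij_betw (gyr x y) G G"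
    and gyr_hom: "\<lbrakk>x \<in> G; y \<in> G; u \<in> G; v \<in> G\<rbrakk>
                    \<Longrightarrow> gyr x y (u \<oplus> v) = gyr x y u \<oplus> gyr x y v"
    and gyr_assoc: "\<lbrakk>x \<in> G; y \<in> G; z \<in> G\<rbrakk>
                    \<Longrightarrow> x \<oplus> (y \<oplus> z) = (x \<oplus> y) \<oplus> gyr x y z"
    and gyr_loop: "\<lbrakk>x \<in> G; y \<in> G; z \<in> G\<rbrakk> \<Longrightarrow> gyr (x \<oplus> y) y z = gyr x y z"

definition is_gyrogroup :: "'a set \<Rightarrow> ('a \<Rightarrow> 'a \<Rightarrow> 'a) \<Rightarrow> bool" where
  "is_gyrogroup G add \<longleftrightarrow> (\<exists>zero neg gyr. gyrogroup G add zero neg gyr)"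

definition set_add :: "('a \<Rightarrow> 'a \<Rightarrow> 'a) \<Rightarrow> 'a set \<Rightarrow> 'a set \<Rightarrow> 'a set" where
  "set_add add A B = {add a b | a b. a \<in> A \<and> b \<in> B}"

definition subgyrogroup ::
    "'a set \<Rightarrow> ('a \<Rightarrow> 'a \<Rightarrow> 'a) \<Rightarrow> ('a \<Rightarrow> 'a \<Rightarrow> 'a \<Rightarrow> 'a) \<Rightarrow> 'a set \<Rightarrow> bool" where
  "subgyrogroup G add gyr H \<longleftrightarrow>
     H \<noteq> {} \<and> H \<subseteq> G \<and>
     (\<forall>x\<in>H. \<forall>y\<in>H. add x y \<in> H) \<and>
     (\<forall>x\<in>H. \<forall>y\<in>H. bij_betw (gyr x y) H (gyr x y ` H) \<and>
        (\<forall>u\<in>H. \<forall>v\<in>H. gyr x y (add u v) = add (gyr x y u) (gyr x y v))) \<and>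
     is_gyrogroup H add"

definition L_subgyrogroup ::
    "'a set \<Rightarrow> ('a \<Rightarrow> 'a \<Rightarrow> 'a) \<Rightarrow> ('a \<Rightarrow> 'a \<Rightarrow> 'a \<Rightarrow> 'a) \<Rightarrow> 'a set \<Rightarrow> bool" where
  "L_subgyrogroup G add gyr H \<longleftrightarrow>
     subgyrogroup G add gyr H \<and> (\<forall>a\<in>G. \<forall>h\<in>H. gyr a h ` H = H)"


section \<open>Topological gyrogroups\<close>

locale topological_gyrogroup = gyrogroup G add zero neg gyr
  for T :: "'a topology" and G :: "'a set" and add zero neg gyr +
  assumes topspace_eq: "topspace T = G"
    and continuous_add: "continuous_map (prod_topology T T) T (\<lambda>(x, y). add x y)"
    and continuous_neg: "continuous_map T T neg"

text \<open>Neighbourhoods are not required to be open.\<close>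

definition nbhd :: "'a topology \<Rightarrow> 'a \<Rightarrow> 'a set \<Rightarrow> bool" where
  "nbhd X x N \<longleftrightarrow> N \<subseteq> topspace X \<and> (\<exists>W. openin X W \<and> x \<in> W \<and> W \<subseteq> N)"

definition nbhd_base :: "'a topology \<Rightarrow> 'a \<Rightarrow> 'a set set \<Rightarrow> bool" where
  "nbhd_base X x \<B> \<longleftrightarrow>
     (\<forall>N\<in>\<B>. nbhd X x N) \<and> (\<forall>W. openin X W \<and> x \<in> W \<longrightarrow> (\<exists>N\<in>\<B>. N \<subseteq> W))"

locale strongly_topological_gyrogroup = topological_gyrogroup T G add zero neg gyr
  for T :: "'a topology" and G :: "'a set" and add zero neg gyr +
  fixes \<U> :: "'a set set"
  assumes nbhd_base_zero: "nbhd_base T zero \<U>"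
    and gyr_invariant: "\<lbrakk>U \<in> \<U>; x \<in> G; y \<in> G\<rbrakk> \<Longrightarrow> gyr x y ` U = U"

definition symmetric_set :: "('a \<Rightarrow> 'a) \<Rightarrow> 'a set \<Rightarrow> bool" where
  "symmetric_set neg A \<longleftrightarrow> neg ` A = A"

definition admissible_sequence ::
    "'a topology \<Rightarrow> ('a \<Rightarrow> 'a \<Rightarrow> 'a) \<Rightarrow> 'a \<Rightarrow> ('a \<Rightarrow> 'a) \<Rightarrow> 'a set \<Rightarrow> (nat \<Rightarrow> 'a set) \<Rightarrow> bool" where
  "admissible_sequence T add zero neg H U \<longleftrightarrow>
     (\<forall>n. openin T (U n) \<and> zero \<in> U n \<and> symmetric_set neg (U n) \<and>
          set_add add (U (Suc n)) (set_add add (U (Suc n)) (U (Suc n))) \<subseteq> U n) \<and>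
     H = (\<Inter>n. U n)"

definition admissible_subgyrogroup ::
    "'a topology \<Rightarrow> 'a set \<Rightarrow> ('a \<Rightarrow> 'a \<Rightarrow> 'a) \<Rightarrow> 'a \<Rightarrow> ('a \<Rightarrow> 'a) \<Rightarrow>
     ('a \<Rightarrow> 'a \<Rightarrow> 'a \<Rightarrow> 'a) \<Rightarrow> 'a set \<Rightarrow> bool" where
  "admissible_subgyrogroup T G add zero neg gyr H \<longleftrightarrow>
     subgyrogroup G add gyr H \<and> (\<exists>U. admissible_sequence T add zero neg H U)"

definition generated_from ::
    "'a topology \<Rightarrow> ('a \<Rightarrow> 'a \<Rightarrow> 'a) \<Rightarrow> 'a \<Rightarrow> ('a \<Rightarrow> 'a) \<Rightarrow> 'a set \<Rightarrow> 'a set set \<Rightarrow> bool" where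
  "generated_from T add zero neg H \<U> \<longleftrightarrow>
     (\<exists>U. admissible_sequence T add zero neg H U \<and> (\<forall>n. U n \<in> \<U>))"

definition neutral_subgyrogroup ::
    "'a topology \<Rightarrow> 'a set \<Rightarrow> ('a \<Rightarrow> 'a \<Rightarrow> 'a) \<Rightarrow> 'a \<Rightarrow> ('a \<Rightarrow> 'a \<Rightarrow> 'a \<Rightarrow> 'a) \<Rightarrow>
     'a set \<Rightarrow> bool" where
  "neutral_subgyrogroup T G add zero gyr H \<longleftrightarrow>
     L_subgyrogroup G add gyr H \<and>
     (\<forall>U. openin T U \<and> zero \<in> U \<longrightarrow>
        (\<exists>V. openin T V \<and> zero \<in> V \<and> set_add add H V \<subseteq> set_add add U H))"


section \<open>The quotient space\<close>

definition left_coset :: "('a \<Rightarrow> 'a \<Rightarrow> 'a) \<Rightarrow> 'a set \<Rightarrow> 'a \<Rightarrow> 'a set" where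
  "left_coset add H a = add a ` H"

definition quotient_space :: "'a topology \<Rightarrow> ('a \<Rightarrow> 'a \<Rightarrow> 'a) \<Rightarrow> 'a set \<Rightarrow> 'a set topology" where
  "quotient_space T add H =
     topology (\<lambda>Q. Q \<subseteq> left_coset add H ` topspace T \<and>
                   openin T {a \<in> topspace T. left_coset add H a \<in> Q})"

lemma openin_quotient_space:
  "openin (quotient_space T add H) Q \<longleftrightarrow>
     Q \<subseteq> left_coset add H ` topspace T \<and> openin T {a \<in> topspace T. left_coset add H a \<in> Q}"
proof -
  let ?p = "left_coset add H"
  let ?L = "\<lambda>Q. Q \<subseteq> ?p ` topspace T \<and> openin T {a \<in> topspace T. ?p a \<in> Q}"
  have "istopology ?L"
    unfolding istopology_def
  proof (intro conjI allI impI)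
    fix S R assume S: "?L S" and R: "?L R"
    then show "S \<inter> R \<subseteq> ?p ` topspace T" by blast
    have "{a \<in> topspace T. ?p a \<in> S \<inter> R} =
            {a \<in> topspace T. ?p a \<in> S} \<inter> {a \<in> topspace T. ?p a \<in> R}" by blast
    then show "openin T {a \<in> topspace T. ?p a \<in> S \<inter> R}"
      using S R by (simp add: openin_Int)
  next
    fix K assume K: "\<forall>S\<in>K. ?L S"
    then show "\<Union>K \<subseteq> ?p ` topspace T" by blast
    have "{a \<in> topspace T. ?p a \<in> \<Union>K} = (\<Union>S\<in>K. {a \<in> topspace T. ?p a \<in> S})" by blast
    then show "openin T {a \<in> topspace T. ?p a \<in> \<Union>K}"
      using K by (simp only:) (rule openin_Union, blast)
  qed
  then show ?thesis
    by (simp add: quotient_space_def topology_inverse')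
qed

lemma topspace_quotient_space:
  "topspace (quotient_space T add H) = left_coset add H ` topspace T"
proof
  show "topspace (quotient_space T add H) \<subseteq> left_coset add H ` topspace T"
    using openin_topspace[of "quotient_space T add H"] unfolding openin_quotient_space by (rule conjunct1)
  have "{a \<in> topspace T. left_coset add H a \<in> left_coset add H ` topspace T} = topspace T"
    by blast
  then have "openin (quotient_space T add H) (left_coset add H ` topspace T)"
    by (simp add: openin_quotient_space)
  then show "left_coset add H ` topspace T \<subseteq> topspace (quotient_space T add H)"
    by (rule openin_subset)
qed

lemma quotient_map_left_coset:
  "quotient_map T (quotient_space T add H) (left_coset add H)"
  by (simp add: quotient_map_def topspace_quotient_space openin_quotient_space)


section \<open>Topological properties\<close>

definition frechet_urysohn :: "'a topology \<Rightarrow> bool" where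
  "frechet_urysohn X \<longleftrightarrow>
     (\<forall>A x. A \<subseteq> topspace X \<and> x \<in> X closure_of A \<longrightarrow>
        (\<exists>s :: nat \<Rightarrow> 'a. (\<forall>n. s n \<in> A) \<and> limitin X s x sequentially))"

text \<open>The order on \<^typ>\<open>nat \<Rightarrow> nat\<close> is the pointwise one.\<close>

definition has_omega_omega_base :: "'a topology \<Rightarrow> bool" where
  "has_omega_omega_base X \<longleftrightarrow>
     (\<forall>x\<in>topspace X. \<exists>U :: (nat \<Rightarrow> nat) \<Rightarrow> 'a set.
        nbhd_base X x (range U) \<and> (\<forall>\<alpha> \<beta>. \<alpha> \<le> \<beta> \<longrightarrow> U \<beta> \<subseteq> U \<alpha>))"

end

theory Submission
  imports Defs
begin

text \<open>
  Members of the base are invariant under all gyrations, hence so is \<open>H\<close>, and left translations act on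
  \<open>G/H\<close> by homeomorphisms. Nyikos' argument for Frechet-Urysohn groups then carries over: given
  sequences \<open>s\<^sub>k\<close> converging to the base point, translate \<open>s\<^sub>k\<close> by \<open>z\<^sub>k\<close>, where \<open>z\<^sub>k H\<close> is a
  nontrivial sequence converging to the base point; a sequence extracted from the union of the
  translates must run through infinitely many \<open>k\<close>, and neutrality makes it possible to translate it back.
  So some convergent sequence meets infinitely many of the \<open>s\<^sub>k\<close>. For an \<open>\<omega>\<^sup>\<omega>\<close>-base \<open>U\<close> this forces,
  for every \<open>\<alpha>\<close>, the intersection of all \<open>U \<beta>\<close> with \<open>\<beta>\<close> agreeing with \<open>\<alpha>\<close> below \<open>k\<close> to be a
  neighbourhood for some \<open>k\<close>, and there are only countably many such intersections.
\<close>

section \<open>Countable bases from \<open>\<omega>\<^sup>\<omega>\<close>-bases\<close>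

text \<open>Arhangel'skii's property \<open>\<alpha>\<^sub>4\<close> at the point \<open>p\<close>.\<close>

definition alpha4_at :: "'a topology \<Rightarrow> 'a \<Rightarrow> bool" where
  "alpha4_at X p \<longleftrightarrow>
     (\<forall>s :: nat \<Rightarrow> nat \<Rightarrow> 'a. (\<forall>k. limitin X (s k) p sequentially) \<longrightarrow>
        (\<exists>\<kappa> \<nu>. filterlim \<kappa> at_top sequentially \<and>
                limitin X (\<lambda>j. s (\<kappa> j) (\<nu> j)) p sequentially))"

text \<open>In coordinate \<open>i\<close> only the finitely many \<open>j\<close> with
  \<open>\<kappa> j \<le> i\<close> may deviate from \<open>\<alpha> i\<close>, so the values there
  are bounded.\<close>

lemma pointwise_upper_bound:
  fixes \<beta> :: "nat \<Rightarrow> nat \<Rightarrow> nat"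
  assumes \<kappa>: "filterlim \<kappa> at_top sequentially"
    and agree: "\<And>j i. i < \<kappa> j \<Longrightarrow> \<beta> j i = \<alpha> i"
  obtains \<gamma> where "\<And>j. \<beta> j \<le> \<gamma>"
proof -
  have "\<exists>m. \<forall>j. \<beta> j i \<le> m" for i
  proof -
    have "eventually (\<lambda>j. Suc i \<le> \<kappa> j) sequentially"
      using \<kappa> by (simp add: filterlim_at_top)
    then obtain J where J: "\<And>j. j \<ge> J \<Longrightarrow> Suc i \<le> \<kappa> j"
      unfolding eventually_sequentially by blast
    have "\<beta> j i \<in> (\<lambda>j. \<beta> j i) ` {..<J} \<union> {\<alpha> i}" for j
      using J[of j] agree[of i j] by (cases "j < J") auto
    then have "\<beta> j i \<le> Max ((\<lambda>j. \<beta> j i) ` {..<J} \<union> {\<alpha> i})" for j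
      by (intro Max_ge) auto
    then show ?thesis by blast
  qed
  then obtain \<gamma> where "\<forall>i j. \<beta> j i \<le> \<gamma> i" by metis
  then have "\<beta> j \<le> \<gamma>" for j by (simp add: le_fun_def)
  then show thesis by (rule that)
qed

lemma countable_base_at_if_omega_omega_base:
  fixes U :: "(nat \<Rightarrow> nat) \<Rightarrow> 'a set"
  assumes FU: "frechet_urysohn X" and "alpha4_at X p" and p: "p \<in> topspace X"
    and base: "nbhd_base X p (range U)" and anti: "\<forall>\<alpha> \<beta>. \<alpha> \<le> \<beta> \<longrightarrow> U \<beta> \<subseteq> U \<alpha>"
  shows "\<exists>\<B>. countable \<B> \<and> (\<forall>V\<in>\<B>. openin X V) \<and>
             (\<forall>W. openin X W \<and> p \<in> W \<longrightarrow> (\<exists>V\<in>\<B>. p \<in> V \<and> V \<subseteq> W))"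
proof -
  \<comment> \<open>Indexing by finite lists makes the family countable; \<open>D \<alpha> k\<close>
    is its member at the first \<open>k\<close> values of \<open>\<alpha>\<close>.\<close>
  define E where "E l = \<Inter> {U \<beta> | \<beta>. \<forall>i < length l. \<beta> i = l ! i}" for l
  define D where "D \<alpha> k = E (map \<alpha> [0..<k])" for \<alpha> k
  have notD: "\<exists>\<beta>. (\<forall>i<k. \<beta> i = \<alpha> i) \<and> x \<notin> U \<beta>" if "x \<notin> D \<alpha> k" for \<alpha> k x
    using that unfolding D_def E_def by auto
  have D_subset: "D \<alpha> k \<subseteq> U \<alpha>" for \<alpha> k
    unfolding D_def E_def by auto
  have D_nbhd: "\<exists>k. p \<in> X interior_of (D \<alpha> k)" for \<alpha>
  proof (rule ccontr)
    assume neg: "\<nexists>k. p \<in> X interior_of (D \<alpha> k)"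
    have "p \<in> X closure_of (topspace X - D \<alpha> k)" for k
      using neg p by (simp add: closure_of_complement)
    then have "\<forall>k. \<exists>s :: nat \<Rightarrow> 'a.
        (\<forall>n. s n \<in> topspace X - D \<alpha> k) \<and> limitin X s p sequentially"
      using FU unfolding frechet_urysohn_def by blast
    from choice[OF this] obtain s :: "nat \<Rightarrow> nat \<Rightarrow> 'a" where
      s: "\<And>k n. s k n \<in> topspace X - D \<alpha> k" "\<And>k. limitin X (s k) p sequentially"
      by blast
    then obtain \<kappa> \<nu> where \<kappa>: "filterlim \<kappa> at_top sequentially"
      and lim: "limitin X (\<lambda>j. s (\<kappa> j) (\<nu> j)) p sequentially"
      using \<open>alpha4_at X p\<close> unfolding alpha4_at_def by blast
    have "\<exists>\<beta>. (\<forall>i<\<kappa> j. \<beta> i = \<alpha> i) \<and> s (\<kappa> j) (\<nu> j) \<notin> U \<beta>" for j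
      using notD s(1) by blast
    then obtain \<beta> where agree: "\<And>j i. i < \<kappa> j \<Longrightarrow> \<beta> j i = \<alpha> i"
      and out: "\<And>j. s (\<kappa> j) (\<nu> j) \<notin> U (\<beta> j)"
      by metis
    \<comment> \<open>One bound \<open>\<gamma>\<close> for all \<open>\<beta> j\<close> puts the
      single neighbourhood \<open>U \<gamma>\<close> inside every \<open>U (\<beta> j)\<close>, yet
      each of these misses a term of a sequence converging to \<open>p\<close>.\<close>
    obtain \<gamma> where \<gamma>: "\<And>j. \<beta> j \<le> \<gamma>"
      by (rule pointwise_upper_bound[OF \<kappa>, of \<beta> \<alpha>]) (use agree in auto)
    have "nbhd X p (U \<gamma>)" using base unfolding nbhd_base_def by blast
    then obtain W where "openin X W" "p \<in> W" "W \<subseteq> U \<gamma>"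
      unfolding nbhd_def by blast
    then have "eventually (\<lambda>j. s (\<kappa> j) (\<nu> j) \<in> W) sequentially"
      using lim unfolding limitin_def by blast
    then obtain j where "s (\<kappa> j) (\<nu> j) \<in> U \<gamma>"
      using \<open>W \<subseteq> U \<gamma>\<close> unfolding eventually_sequentially by blast
    then show False using anti[rule_format, OF \<gamma>[of j]] out[of j] by blast
  qed
  show ?thesis
  proof (intro exI[of _ "range (\<lambda>l. X interior_of (E l))"] conjI allI impI ballI)
    show "countable (range (\<lambda>l. X interior_of (E l)))" by simp
    show "openin X V" if "V \<in> range (\<lambda>l. X interior_of (E l))" for V
      using that by auto
    show "\<exists>V\<in>range (\<lambda>l. X interior_of (E l)). p \<in> V \<and> V \<subseteq> W" if W: "openin X W \<and> p \<in> W" for W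
    proof -
      obtain \<alpha> where "U \<alpha> \<subseteq> W" using base W unfolding nbhd_base_def by blast
      moreover obtain k where "p \<in> X interior_of (D \<alpha> k)" using D_nbhd by blast
      ultimately show ?thesis
        using D_subset[of \<alpha> k] interior_of_subset[of X "D \<alpha> k"] unfolding D_def by blast
    qed
  qed
qed


section \<open>Gyrogroup identities\<close>

context gyrogroup
begin

lemma gyr_closed: "\<lbrakk>x \<in> G; y \<in> G; z \<in> G\<rbrakk> \<Longrightarrow> gyr x y z \<in> G"
  using bij_betw_apply[OF gyr_bij] by simp

lemma gyr_surj:
  assumes "x \<in> G" "y \<in> G" "z \<in> G"
  obtains w where "w \<in> G" "gyr x y w = z"
proof -
  have "z \<in> gyr x y ` G" using gyr_bij[OF assms(1,2)] assms(3) by (simp add: bij_betw_def)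
  then show thesis using that by (rule imageE) auto
qed

lemma gyr_inj:
  assumes "x \<in> G" "y \<in> G" "u \<in> G" "v \<in> G" "gyr x y u = gyr x y v"
  shows "u = v"
  using inj_onD[OF bij_betw_imp_inj_on[OF gyr_bij[OF assms(1,2)]] assms(5,3,4)] .

text \<open>Left cancellation up to a gyration, which \<open>neg_add_cancel\<close> removes once
  \<open>gyr \<zero> a\<close> is known to be the identity on \<open>G\<close>.\<close>

lemma neg_add_assoc:
  assumes "a \<in> G" "b \<in> G"
  shows "\<ominus> a \<oplus> (a \<oplus> b) = gyr (\<ominus> a) a b"
  using gyr_assoc[of "\<ominus> a" a b] assms by (simp add: neg_closed neg_left zero_left gyr_closed)

lemma add_left_cancel:
  assumes "a \<in> G" "b \<in> G" "c \<in> G" "a \<oplus> b = a \<oplus> c"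
  shows "b = c"
  using assms neg_add_assoc[of a b] neg_add_assoc[of a c] gyr_inj[of "\<ominus> a" a b c]
  by (simp add: neg_closed)

text \<open>Reassociating \<open>\<zero> \<oplus> (a \<oplus> b)\<close> produces this gyration
  behind \<open>a\<close>, and \<open>a\<close> cancels.\<close>

lemma gyr_zero_left:
  assumes "a \<in> G" "b \<in> G"
  shows "gyr \<zero> a b = b"
  using gyr_assoc[of \<zero> a b] add_left_cancel[of a "gyr \<zero> a b" b] assms
  by (simp add: zero_closed zero_left add_closed gyr_closed)

text \<open>The loop property turns \<open>gyr (\<ominus> a) a\<close> into
  \<open>gyr \<zero> a\<close>.\<close>

lemma neg_add_cancel:
  assumes "a \<in> G" "b \<in> G"
  shows "\<ominus> a \<oplus> (a \<oplus> b) = b"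
  using neg_add_assoc[OF assms] gyr_loop[of "\<ominus> a" a b] gyr_zero_left[OF assms] assms
  by (simp add: neg_closed neg_left)

lemma neg_neg: "a \<in> G \<Longrightarrow> \<ominus> (\<ominus> a) = a"
  using neg_unique[of "\<ominus> a" a] by (simp add: neg_closed neg_left neg_right)

lemma add_neg_cancel:
  assumes "a \<in> G" "b \<in> G"
  shows "a \<oplus> (\<ominus> a \<oplus> b) = b"
  using neg_add_cancel[of "\<ominus> a" b] assms by (simp add: neg_closed neg_neg)

text \<open>On the right, cancelling \<open>b\<close> takes a gyrated inverse of \<open>b\<close>:
  reassociate \<open>a \<oplus> (b \<oplus> \<ominus> b)\<close>.\<close>

lemma add_right_cancel_gyr:
  assumes "a \<in> G" "b \<in> G"
  shows "(a \<oplus> b) \<oplus> gyr a b (\<ominus> b) = a"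
  using gyr_assoc[of a b "\<ominus> b"] assms by (simp add: neg_closed neg_right zero_right)

end


section \<open>Quotients by neutral admissible subgyrogroups\<close>

text \<open>Fixing \<open>S\<close> inside \<open>\<U>\<close> gives each \<open>S n\<close>
  symmetry and gyration invariance, both of which pass to the intersection \<open>H\<close>.\<close>

locale neutral_admissible_quotient = strongly_topological_gyrogroup T G add zero neg gyr \<U>
  for T :: "'a topology" and G :: "'a set"
    and add :: "'a \<Rightarrow> 'a \<Rightarrow> 'a"  (infixl "\<oplus>" 65)
    and zero :: 'a  ("\<zero>")
    and neg :: "'a \<Rightarrow> 'a"  ("\<ominus> _" [81] 80)
    and gyr :: "'a \<Rightarrow> 'a \<Rightarrow> 'a \<Rightarrow> 'a"
    and \<U> :: "'a set set" +
  fixes H :: "'a set" and S :: "nat \<Rightarrow> 'a set"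
  assumes symmetric: "U \<in> \<U> \<Longrightarrow> symmetric_set neg U"
    and admissible: "admissible_sequence T add zero neg H S"
    and S_in_base: "S n \<in> \<U>"
    and neutral: "\<lbrakk>openin T U; \<zero> \<in> U\<rbrakk>
        \<Longrightarrow> \<exists>V. openin T V \<and> \<zero> \<in> V \<and> set_add add H V \<subseteq> set_add add U H"
begin

abbreviation Q :: "'a set topology" where "Q \<equiv> quotient_space T add H"
abbreviation \<pi> :: "'a \<Rightarrow> 'a set" where "\<pi> \<equiv> left_coset add H"

section \<open>Closure properties of the sequence \<open>S\<close> and of \<open>H\<close>\<close>

lemma S_open: "openin T (S n)" and S_zero: "\<zero> \<in> S n"
  and S_sum3: "\<lbrakk>a \<in> S (Suc n); b \<in> S (Suc n); c \<in> S (Suc n)\<rbrakk> \<Longrightarrow> a \<oplus> (b \<oplus> c) \<in> S n"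
  and H_eq: "H = (\<Inter>n. S n)"
  using admissible unfolding admissible_sequence_def set_add_def by blast+

lemma S_G: "S n \<subseteq> G"
  using S_open openin_subset topspace_eq by metis

lemma H_G: "H \<subseteq> G"
  using H_eq S_G by blast

lemma H_closed: "h \<in> H \<Longrightarrow> h \<in> G"
  using H_G by blast

lemma H_zero: "\<zero> \<in> H"
  using H_eq S_zero by blast

lemma S_sum2:
  assumes "a \<in> S (Suc n)" "b \<in> S (Suc n)"
  shows "a \<oplus> b \<in> S n"
  using S_sum3[OF S_zero assms] assms S_G by (metis add_closed subsetD zero_left)

lemma H_add: "\<lbrakk>h \<in> H; k \<in> H\<rbrakk> \<Longrightarrow> h \<oplus> k \<in> H"
  unfolding H_eq using S_sum2 by blast

lemma base_neg: "\<lbrakk>U \<in> \<U>; x \<in> U\<rbrakk> \<Longrightarrow> \<ominus> x \<in> U"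
  using symmetric[of U] by (auto simp: symmetric_set_def)

lemma H_neg: "h \<in> H \<Longrightarrow> \<ominus> h \<in> H"
  unfolding H_eq using base_neg S_in_base by blast

lemma base_gyr: "\<lbrakk>U \<in> \<U>; x \<in> G; y \<in> G; u \<in> U\<rbrakk> \<Longrightarrow> gyr x y u \<in> U"
  using gyr_invariant[of U x y] by auto

lemma H_gyr: "\<lbrakk>x \<in> G; y \<in> G; h \<in> H\<rbrakk> \<Longrightarrow> gyr x y h \<in> H"
  unfolding H_eq using base_gyr S_in_base by blast

text \<open>By injectivity the preimages of \<open>h\<close> found in the various \<open>S n\<close>
  are one and the same \<open>k\<close>, which therefore lies in \<open>H\<close>.\<close>

lemma H_gyr_surj:
  assumes "x \<in> G" "y \<in> G" "h \<in> H"
  obtains k where "k \<in> H" "gyr x y k = h"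
proof -
  obtain k where k: "k \<in> G" "gyr x y k = h"
    using gyr_surj assms H_closed by metis
  have "k \<in> S n" for n
  proof -
    have "h \<in> gyr x y ` S n"
      using assms gyr_invariant[OF S_in_base, of x y n] H_eq by simp
    then obtain k' where "k' \<in> S n" "gyr x y k' = h" by blast
    then show ?thesis using gyr_inj k assms S_G by (metis subsetD)
  qed
  then show thesis using that k H_eq by blast
qed

section \<open>Left cosets of \<open>H\<close>\<close>

lemma coset_mem: "x \<in> \<pi> a \<longleftrightarrow> (\<exists>h\<in>H. x = a \<oplus> h)"
  unfolding left_coset_def by blast

text \<open>Both inclusions reassociate: one pulls \<open>k\<close> back through
  \<open>gyr a h\<close> inside \<open>H\<close>, the other writes \<open>k\<close> as
  \<open>h \<oplus> (\<ominus> h \<oplus> k)\<close>.\<close>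

lemma coset_add:
  assumes "a \<in> G" "h \<in> H"
  shows "\<pi> (a \<oplus> h) = \<pi> a"
proof (intro equalityI subsetI)
  fix x assume "x \<in> \<pi> (a \<oplus> h)"
  then obtain k where k: "k \<in> H" "x = (a \<oplus> h) \<oplus> k" unfolding coset_mem by blast
  obtain k' where "k' \<in> H" "gyr a h k' = k" using H_gyr_surj assms k H_closed by metis
  then have "x = a \<oplus> (h \<oplus> k')" using gyr_assoc assms k H_closed by metis
  then show "x \<in> \<pi> a" using H_add assms \<open>k' \<in> H\<close> unfolding coset_mem by blast
next
  fix x assume "x \<in> \<pi> a"
  then obtain k where k: "k \<in> H" "x = a \<oplus> k" unfolding coset_mem by blast
  let ?k = "\<ominus> h \<oplus> k"
  have "?k \<in> H" using H_add H_neg k assms by blast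
  moreover have "a \<oplus> k = (a \<oplus> h) \<oplus> gyr a h ?k"
    using gyr_assoc[of a h ?k] add_neg_cancel[of h k] assms k H_closed \<open>?k \<in> H\<close> by metis
  ultimately show "x \<in> \<pi> (a \<oplus> h)"
    using H_gyr assms k H_closed unfolding coset_mem by metis
qed

lemma coset_eq_iff:
  assumes "a \<in> G" "b \<in> G"
  shows "\<pi> a = \<pi> b \<longleftrightarrow> (\<exists>h\<in>H. a = b \<oplus> h)"
proof
  assume "\<pi> a = \<pi> b"
  moreover have "a \<in> \<pi> a" using assms H_zero zero_right unfolding coset_mem by metis
  ultimately show "\<exists>h\<in>H. a = b \<oplus> h" using coset_mem by blast
qed (use coset_add assms in blast)

section \<open>The quotient topology: openness of \<open>\<pi>\<close>, left translations,
  separation\<close>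

lemma topspace_Q: "topspace Q = \<pi> ` G"
  by (simp add: topspace_quotient_space topspace_eq)

lemma openin_preimage: "openin Q W \<Longrightarrow> openin T {a \<in> G. \<pi> a \<in> W}"
  by (simp add: openin_quotient_space topspace_eq)

lemma continuous_map_pi: "continuous_map T Q \<pi>"
  using quotient_map_left_coset quotient_imp_continuous_map by blast

lemma continuous_map_add:
  assumes "continuous_map X T f" "continuous_map X T g"
  shows "continuous_map X T (\<lambda>x. f x \<oplus> g x)"
  using continuous_map_compose[OF continuous_map_pairedI[OF assms] continuous_add]
  by (simp add: o_def)

lemma continuous_map_add_left: "a \<in> G \<Longrightarrow> continuous_map T T (\<lambda>x. a \<oplus> x)"
  by (intro continuous_map_add) (auto simp: topspace_eq)

lemma continuous_map_add_right: "a \<in> G \<Longrightarrow> continuous_map T T (\<lambda>x. x \<oplus> a)"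
  by (intro continuous_map_add) (auto simp: topspace_eq)

text \<open>The saturation of \<open>V\<close> is a union of preimages of \<open>V\<close> under
  right translations by elements of \<open>H\<close>.\<close>

lemma openin_coset_image:
  assumes V: "openin T V"
  shows "openin Q (\<pi> ` V)"
proof -
  have VG: "V \<subseteq> G" using V openin_subset topspace_eq by metis
  have "{a \<in> G. \<pi> a \<in> \<pi> ` V} = (\<Union>h\<in>H. {a \<in> topspace T. a \<oplus> h \<in> V})"
  proof (intro equalityI subsetI)
    fix a assume "a \<in> {a \<in> G. \<pi> a \<in> \<pi> ` V}"
    then obtain v where "a \<in> G" "v \<in> V" "\<pi> v = \<pi> a" by auto
    then show "a \<in> (\<Union>h\<in>H. {a \<in> topspace T. a \<oplus> h \<in> V})"
      using coset_eq_iff[of v a] VG topspace_eq by auto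
  next
    fix a assume "a \<in> (\<Union>h\<in>H. {a \<in> topspace T. a \<oplus> h \<in> V})"
    then obtain h where "h \<in> H" "a \<in> G" "a \<oplus> h \<in> V" using topspace_eq by auto
    then show "a \<in> {a \<in> G. \<pi> a \<in> \<pi> ` V}" using coset_add by (metis (mono_tags) imageI mem_Collect_eq)
  qed
  also have "openin T \<dots>"
    using openin_continuous_map_preimage[OF continuous_map_add_right V] H_closed by blast
  finally show ?thesis
    using VG by (auto simp: openin_quotient_space topspace_eq)
qed

text \<open>Gyrations map \<open>H\<close> onto itself, so reassociation carries cosets onto cosets
  and left translations descend to the quotient.\<close>

lemma image_coset:
  assumes "x \<in> G" "a \<in> G"
  shows "add x ` \<pi> a = \<pi> (x \<oplus> a)"
proof (intro equalityI subsetI)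
  fix y assume "y \<in> add x ` \<pi> a"
  then obtain h where "h \<in> H" "y = x \<oplus> (a \<oplus> h)" unfolding left_coset_def by blast
  then show "y \<in> \<pi> (x \<oplus> a)" using gyr_assoc H_gyr assms H_closed unfolding coset_mem by metis
next
  fix y assume "y \<in> \<pi> (x \<oplus> a)"
  then obtain h where h: "h \<in> H" "y = (x \<oplus> a) \<oplus> h" unfolding coset_mem by blast
  obtain k where "k \<in> H" "gyr x a k = h" using H_gyr_surj h assms by blast
  then have "y = x \<oplus> (a \<oplus> k)" "a \<oplus> k \<in> \<pi> a"
    using h gyr_assoc assms H_closed unfolding left_coset_def by auto
  then show "y \<in> add x ` \<pi> a" by blast
qed

lemma continuous_map_translation:
  assumes "x \<in> G"
  shows "continuous_map Q Q ((`) (add x))"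
proof -
  have "continuous_map T Q (\<pi> \<circ> (\<lambda>a. x \<oplus> a))"
    using continuous_map_compose continuous_map_add_left continuous_map_pi assms by blast
  then have "continuous_map T Q ((`) (add x) \<circ> \<pi>)"
    by (rule continuous_map_eq) (use image_coset assms topspace_eq in auto)
  then show ?thesis
    using continuous_compose_quotient_map_eq[OF quotient_map_left_coset] by blast
qed

text \<open>If small neighbourhoods of the two cosets met, then \<open>z\<close> would be a sum of
  two elements of \<open>S (Suc n)\<close> and so lie in \<open>S n\<close>, which was chosen to
  miss it.\<close>

lemma coset_separation:
  assumes z: "z \<in> G" "\<pi> z \<noteq> \<pi> \<zero>"
  obtains A B where "openin Q A" "openin Q B" "\<pi> z \<in> A" "\<pi> \<zero> \<in> B" "A \<inter> B = {}"
proof -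
  have "z \<notin> H"
    using z coset_eq_iff[of z \<zero>] zero_left zero_closed by metis
  then obtain n where n: "z \<notin> S n" using H_eq by blast
  \<comment> \<open>One index is spent on adding \<open>h\<close> to \<open>v\<close>, the other on
    adding the gyrated inverse of \<open>w\<close>.\<close>
  define V where "V = S (Suc (Suc n))"
  define B where "B = \<pi> ` V"
  \<comment> \<open>This is the image of the left translate of \<open>V\<close> by \<open>z\<close>,
    written as a preimage so that openness is immediate.\<close>
  define A where "A = \<pi> ` {a \<in> topspace T. \<ominus> z \<oplus> a \<in> V}"
  have "openin T V" unfolding V_def by (rule S_open)
  then have "openin Q A" "openin Q B"
    unfolding A_def B_def using z neg_closed continuous_map_add_left
    by (auto intro!: openin_coset_image openin_continuous_map_preimage)
  moreover have "\<pi> z \<in> A" "\<pi> \<zero> \<in> B"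
    unfolding A_def B_def V_def using z S_zero neg_left topspace_eq by auto
  moreover have "A \<inter> B = {}"
  proof (rule ccontr)
    assume "A \<inter> B \<noteq> {}"
    then obtain a v where a: "a \<in> G" "\<ominus> z \<oplus> a \<in> V" and v: "v \<in> V" "\<pi> a = \<pi> v"
      unfolding A_def B_def using topspace_eq by auto
    have vG: "v \<in> G" using v S_G unfolding V_def by blast
    then obtain h where h: "h \<in> H" "a = v \<oplus> h" using coset_eq_iff a v by blast
    then have "h \<in> V" unfolding V_def H_eq by blast
    then have aS: "a \<in> S (Suc n)" using h v S_sum2 unfolding V_def by blast
    define w where "w = \<ominus> z \<oplus> a"
    have wG: "w \<in> G" using a S_G unfolding w_def V_def by blast
    have az: "a = z \<oplus> w" unfolding w_def using add_neg_cancel a z by metis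
    \<comment> \<open>Adding \<open>\<zero>\<close> shows that elements of \<open>V\<close> lie in
      \<open>S (Suc n)\<close>.\<close>
    have "w = w \<oplus> \<zero>" using wG zero_right by metis
    then have "w \<in> S (Suc n)" using a S_sum2 S_zero unfolding V_def w_def by metis
    then have "gyr z w (\<ominus> w) \<in> S (Suc n)"
      using base_gyr base_neg S_in_base z wG by blast
    then have "a \<oplus> gyr z w (\<ominus> w) \<in> S n" using aS S_sum2 by blast
    then show False using n az add_right_cancel_gyr z wG by metis
  qed
  ultimately show thesis by (rule that)
qed

section \<open>Undoing translations near the base point\<close>

lemma ex_open_sum:
  assumes V: "openin T V" "\<zero> \<in> V"
  obtains W where "openin T W" "\<zero> \<in> W" "\<And>a b. \<lbrakk>a \<in> W; b \<in> W\<rbrakk> \<Longrightarrow> a \<oplus> b \<in> V"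
proof -
  define P where "P = {p \<in> topspace (prod_topology T T). (case p of (x, y) \<Rightarrow> x \<oplus> y) \<in> V}"
  have "openin (prod_topology T T) P"
    unfolding P_def by (rule openin_continuous_map_preimage[OF continuous_add V(1)])
  moreover have "(\<zero>, \<zero>) \<in> P"
    unfolding P_def using V zero_closed zero_left topspace_eq by auto
  ultimately have "\<exists>A B. openin T A \<and> openin T B \<and> \<zero> \<in> A \<and> \<zero> \<in> B \<and> A \<times> B \<subseteq> P"
    by (simp add: openin_prod_topology_alt)
  then obtain A B where AB: "openin T A" "openin T B" "\<zero> \<in> A" "\<zero> \<in> B" "A \<times> B \<subseteq> P"
    by blast
  show thesis
  proof (rule that)
    show "openin T (A \<inter> B)" "\<zero> \<in> A \<inter> B" using AB by auto
    show "a \<oplus> b \<in> V" if "a \<in> A \<inter> B" "b \<in> A \<inter> B" for a b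
    proof -
      have "(a, b) \<in> P" using AB(5) that by blast
      then show ?thesis by (simp add: P_def)
    qed
  qed
qed

lemma base_below:
  assumes "openin T V" "\<zero> \<in> V"
  obtains U where "U \<in> \<U>" "U \<subseteq> V"
  using nbhd_base_zero assms unfolding nbhd_base_def by blast

lemma open_below_base:
  assumes "U \<in> \<U>"
  obtains V where "openin T V" "\<zero> \<in> V" "V \<subseteq> U"
proof -
  have "nbhd T \<zero> U" using nbhd_base_zero assms unfolding nbhd_base_def by blast
  then show thesis using that unfolding nbhd_def by blast
qed

text \<open>In a group, z = vh and zx = v'h' give x = h^-1 (v^-1 v') h', and neutrality rewrites
  h^-1 (v^-1 v') as a small element times one of \<open>H\<close>. Here each reassociation adds a
  gyration, absorbed by the invariance of \<open>H\<close> and of the base.\<close>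

lemma ex_open_coset_difference:
  assumes O: "openin T O'" "\<zero> \<in> O'"
  obtains V where "openin T V" "\<zero> \<in> V"
    "\<And>z x. \<lbrakk>z \<in> G; x \<in> G; \<pi> z \<in> \<pi> ` V; \<pi> (z \<oplus> x) \<in> \<pi> ` V\<rbrakk> \<Longrightarrow> \<pi> x \<in> \<pi> ` O'"
proof -
  \<comment> \<open>Members of \<open>\<U>\<close> bring symmetry and invariance but may fail to be
    open, so they alternate with open sets: \<open>N\<close> will contain
    \<open>\<ominus> v\<close>, and \<open>U\<close> the final gyration of \<open>u\<close>.\<close>
  obtain U where U: "U \<in> \<U>" "U \<subseteq> O'" using base_below[OF O] .
  obtain U' where U': "openin T U'" "\<zero> \<in> U'" "U' \<subseteq> U" using open_below_base[OF U(1)] .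
  obtain V1 where V1: "openin T V1" "\<zero> \<in> V1" "set_add add H V1 \<subseteq> set_add add U' H"
    using neutral[OF U'(1,2)] by blast
  obtain V2 where V2: "openin T V2" "\<zero> \<in> V2" "\<And>a b. \<lbrakk>a \<in> V2; b \<in> V2\<rbrakk> \<Longrightarrow> a \<oplus> b \<in> V1"
    by (rule ex_open_sum[OF V1(1,2)]) auto
  obtain N where N: "N \<in> \<U>" "N \<subseteq> V2" using base_below[OF V2(1,2)] .
  obtain V where V: "openin T V" "\<zero> \<in> V" "V \<subseteq> N" using open_below_base[OF N(1)] .
  have G: "V \<subseteq> G" "V1 \<subseteq> G" "U' \<subseteq> G"
    using V(1) V1(1) U'(1) openin_subset topspace_eq by auto
  have "\<pi> x \<in> \<pi> ` O'"
    if zx: "z \<in> G" "x \<in> G" "\<pi> z \<in> \<pi> ` V" "\<pi> (z \<oplus> x) \<in> \<pi> ` V" for z x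
  proof -
    have zxG: "z \<oplus> x \<in> G" using zx add_closed by blast
    obtain v where "v \<in> V" "\<pi> z = \<pi> v" using zx by blast
    then obtain h where v: "v \<in> V" "v \<in> G" "h \<in> H" "h \<in> G" "z = v \<oplus> h"
      using coset_eq_iff zx G H_closed by (metis subsetD)
    obtain v' where "v' \<in> V" "\<pi> (z \<oplus> x) = \<pi> v'" using zx by blast
    then obtain h' where v': "v' \<in> V" "v' \<in> G" "h' \<in> H" "h' \<in> G" "z \<oplus> x = v' \<oplus> h'"
      using coset_eq_iff zxG G H_closed by (metis subsetD)
    \<comment> \<open>\<open>y\<close> is chosen so that reassociating
      \<open>(v \<oplus> h) \<oplus> x\<close> leaves no gyration.\<close>
    obtain y where y: "y \<in> G" "gyr v h y = x" using gyr_surj v zx by metis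
    have "v \<oplus> (h \<oplus> y) = v' \<oplus> h'" using gyr_assoc v v' y by metis
    then have "\<ominus> v \<oplus> (v' \<oplus> h') = h \<oplus> y" using neg_add_cancel add_closed v y by metis
    moreover have "\<ominus> v \<oplus> (v' \<oplus> h') = (\<ominus> v \<oplus> v') \<oplus> gyr (\<ominus> v) v' h'"
      using gyr_assoc neg_closed v v' by blast
    moreover define w where "w = \<ominus> v \<oplus> v'"
    moreover define k where "k = gyr (\<ominus> v) v' h'"
    ultimately have hy: "h \<oplus> y = w \<oplus> k" by simp
    have k: "k \<in> H" unfolding k_def using H_gyr v v' neg_closed by blast
    have "\<ominus> v \<in> V2" "v' \<in> V2" using base_neg N V v v' by blast+
    then have wV: "w \<in> V1" unfolding w_def using V2 by blast
    have wG: "w \<in> G" using wV G by blast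
    have nh: "\<ominus> h \<in> H" "\<ominus> h \<in> G" using H_neg v H_closed by blast+
    have "\<ominus> h \<oplus> w \<in> set_add add U' H"
      using V1(3) nh wV unfolding set_add_def by blast
    then obtain u l where u: "u \<in> U'" "l \<in> H" "\<ominus> h \<oplus> w = u \<oplus> l"
      unfolding set_add_def by blast
    have uG: "u \<in> G" "l \<in> G" using u G H_closed by blast+
    have "y = \<ominus> h \<oplus> (w \<oplus> k)" using neg_add_cancel v y hy by metis
    also have "\<dots> = (u \<oplus> l) \<oplus> gyr (\<ominus> h) w k" using gyr_assoc u nh wG k H_closed by metis
    finally have "\<pi> y = \<pi> u"
      using coset_add[of "u \<oplus> l"] coset_add[of u l] add_closed u uG H_gyr[OF nh(2) wG k] by metis
    then obtain m where m: "m \<in> H" "y = u \<oplus> m" using coset_eq_iff y uG by blast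
    \<comment> \<open>Applying \<open>gyr v h\<close> returns from \<open>y\<close> to
      \<open>x\<close>, and the image of \<open>u\<close> stays in \<open>U\<close>.\<close>
    then have "x = gyr v h u \<oplus> gyr v h m" using gyr_hom v uG y H_closed by metis
    then have "\<pi> x = \<pi> (gyr v h u)"
      using coset_add gyr_closed H_gyr v uG m by metis
    moreover have "gyr v h u \<in> O'" using base_gyr U U' u v by blast
    ultimately show ?thesis by blast
  qed
  then show thesis using that V by blast
qed

lemma limitin_untranslate:
  assumes z: "\<And>j. z j \<in> G" and x: "\<And>j. x j \<in> G"
    and limz: "limitin Q (\<lambda>j. \<pi> (z j)) (\<pi> \<zero>) F"
    and limzx: "limitin Q (\<lambda>j. \<pi> (z j \<oplus> x j)) (\<pi> \<zero>) F"
  shows "limitin Q (\<lambda>j. \<pi> (x j)) (\<pi> \<zero>) F"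
  unfolding limitin_def
proof (intro conjI allI impI)
  show "\<pi> \<zero> \<in> topspace Q" using limz by (simp add: limitin_def)
  fix W assume W: "openin Q W \<and> \<pi> \<zero> \<in> W"
  obtain V where V: "openin T V" "\<zero> \<in> V"
    "\<And>z x. \<lbrakk>z \<in> G; x \<in> G; \<pi> z \<in> \<pi> ` V; \<pi> (z \<oplus> x) \<in> \<pi> ` V\<rbrakk> \<Longrightarrow> \<pi> x \<in> \<pi> ` {a \<in> G. \<pi> a \<in> W}"
    using ex_open_coset_difference[of "{a \<in> G. \<pi> a \<in> W}"] openin_preimage W zero_closed by blast
  have "openin Q (\<pi> ` V)" "\<pi> \<zero> \<in> \<pi> ` V" using V openin_coset_image by auto
  then have "\<forall>\<^sub>F j in F. \<pi> (z j) \<in> \<pi> ` V" "\<forall>\<^sub>F j in F. \<pi> (z j \<oplus> x j) \<in> \<pi> ` V"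
    using limz limzx by (auto simp: limitin_def)
  then show "\<forall>\<^sub>F j in F. \<pi> (x j) \<in> W"
  proof eventually_elim
    case (elim j)
    then have "\<pi> (x j) \<in> \<pi> ` {a \<in> G. \<pi> a \<in> W}" using V(3) z x by blast
    then show ?case by auto
  qed
qed

section \<open>Property \<alpha>4 and first countability of the quotient\<close>

lemma alpha4_quotient:
  assumes FU: "frechet_urysohn Q"
  shows "alpha4_at Q (\<pi> \<zero>)"
  unfolding alpha4_at_def
proof (intro allI impI)
  fix s :: "nat \<Rightarrow> nat \<Rightarrow> 'a set"
  assume s: "\<forall>k. limitin Q (s k) (\<pi> \<zero>) sequentially"
  have p: "\<pi> \<zero> \<in> topspace Q" using s by (auto simp: limitin_def)
  show "\<exists>\<kappa> \<nu>. filterlim \<kappa> at_top sequentially \<and>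
          limitin Q (\<lambda>j. s (\<kappa> j) (\<nu> j)) (\<pi> \<zero>) sequentially"
  proof (cases "openin Q {\<pi> \<zero>}")
    \<comment> \<open>Every \<open>s k\<close> hits an isolated base point, so
      \<open>\<kappa>\<close> can be the identity.\<close>
    case True
    have "\<exists>n. s k n = \<pi> \<zero>" for k
    proof -
      have "\<forall>\<^sub>F n in sequentially. s k n \<in> {\<pi> \<zero>}"
        using s True unfolding limitin_def by blast
      then show ?thesis unfolding eventually_sequentially by auto
    qed
    then obtain \<nu> where "\<And>k. s k (\<nu> k) = \<pi> \<zero>" by metis
    then have "limitin Q (\<lambda>j. s j (\<nu> j)) (\<pi> \<zero>) sequentially"
      using p by (simp add: limitin_def)
    then show ?thesis using filterlim_ident by blast
  next
    case False
    have "\<pi> \<zero> \<in> Q closure_of (topspace Q - {\<pi> \<zero>})"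
      unfolding in_closure_of
    proof (intro conjI p allI impI)
      fix W assume W: "\<pi> \<zero> \<in> W \<and> openin Q W"
      then have "W \<noteq> {\<pi> \<zero>}" using False by blast
      then show "\<exists>y. y \<in> topspace Q - {\<pi> \<zero>} \<and> y \<in> W" using W openin_subset by blast
    qed
    then obtain z' where z': "\<And>k :: nat. z' k \<in> topspace Q - {\<pi> \<zero>}"
      and limz': "limitin Q z' (\<pi> \<zero>) sequentially"
      using FU[unfolded frechet_urysohn_def, rule_format, of "topspace Q - {\<pi> \<zero>}" "\<pi> \<zero>"] by blast
    have "\<exists>z. z \<in> G \<and> z' k = \<pi> z" for k using z'[of k] topspace_Q by auto
    then obtain z where z: "\<And>k. z k \<in> G" "\<And>k. z' k = \<pi> (z k)" by metis
    have limz: "limitin Q (\<lambda>k. \<pi> (z k)) (\<pi> \<zero>) sequentially"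
      using limz' z(2) by (simp add: limitin_def)
    have "\<exists>A B. openin Q A \<and> openin Q B \<and> \<pi> (z k) \<in> A \<and> \<pi> \<zero> \<in> B \<and> A \<inter> B = {}" for k
      using coset_separation[of "z k"] z z'[of k] by (metis DiffD2 singletonI)
    then obtain A B where AB: "\<And>k. openin Q (A k)" "\<And>k. openin Q (B k)" "\<And>k. \<pi> (z k) \<in> A k"
      "\<And>k. \<pi> \<zero> \<in> B k" "\<And>k. A k \<inter> B k = {}" by metis
    have lim_tr: "limitin Q (\<lambda>n. add (z k) ` s k n) (\<pi> (z k)) sequentially" for k
    proof -
      have "limitin Q ((`) (add (z k)) \<circ> s k) (add (z k) ` \<pi> \<zero>) sequentially"
        using continuous_map_limit[OF continuous_map_translation[OF z(1)]] s by blast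
      then show ?thesis by (simp add: o_def image_coset z zero_closed zero_right)
    qed
    \<comment> \<open>Trimming the translate of \<open>s k\<close> to \<open>A k\<close> keeps it
      away from the base point, so that convergence to the base point will force the index to
      infinity. Terms must be required to be cosets, since convergence guarantees this only
      eventually.\<close>
    define M where "M = {add (z k) ` s k n | k n. s k n \<in> topspace Q \<and> add (z k) ` s k n \<in> A k}"
    have ev: "\<forall>\<^sub>F n in sequentially. s k n \<in> topspace Q \<and> add (z k) ` s k n \<in> A k \<inter> W"
      if "openin Q W" "\<pi> (z k) \<in> W" for k W
    proof (rule eventually_conj)
      show "\<forall>\<^sub>F n in sequentially. s k n \<in> topspace Q"
        using s p openin_topspace unfolding limitin_def by blast
      have "openin Q (A k \<inter> W)" "\<pi> (z k) \<in> A k \<inter> W" using AB that by auto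
      then show "\<forall>\<^sub>F n in sequentially. add (z k) ` s k n \<in> A k \<inter> W"
        using lim_tr[of k] unfolding limitin_def by blast
    qed
    \<comment> \<open>An iterated limit: \<open>W\<close> contains some \<open>\<pi> (z k)\<close>,
      to which the translates of \<open>s k\<close> converge.\<close>
    have "\<pi> \<zero> \<in> Q closure_of M"
      unfolding in_closure_of
    proof (intro conjI p allI impI)
      fix W assume W: "\<pi> \<zero> \<in> W \<and> openin Q W"
      then have "\<forall>\<^sub>F k in sequentially. \<pi> (z k) \<in> W" using limz by (simp add: limitin_def)
      then obtain k where "\<pi> (z k) \<in> W" unfolding eventually_sequentially by blast
      then obtain n where "s k n \<in> topspace Q \<and> add (z k) ` s k n \<in> A k \<inter> W"
        using ev W unfolding eventually_sequentially by blast
      then show "\<exists>y. y \<in> M \<and> y \<in> W" unfolding M_def by blast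
    qed
    moreover have "M \<subseteq> topspace Q" unfolding M_def using AB(1) openin_subset by blast
    ultimately obtain t where t: "\<And>j :: nat. t j \<in> M" "limitin Q t (\<pi> \<zero>) sequentially"
      using FU unfolding frechet_urysohn_def by meson
    have "\<exists>k n. t j = add (z k) ` s k n \<and> s k n \<in> topspace Q \<and> t j \<in> A k" for j
    proof -
      obtain k n where "t j = add (z k) ` s k n" "s k n \<in> topspace Q" "add (z k) ` s k n \<in> A k"
        using t(1)[of j] unfolding M_def by blast
      then show ?thesis by metis
    qed
    then obtain \<kappa> \<nu> where \<kappa>\<nu>: "\<And>j. t j = add (z (\<kappa> j)) ` s (\<kappa> j) (\<nu> j)"
      "\<And>j. s (\<kappa> j) (\<nu> j) \<in> topspace Q" "\<And>j. t j \<in> A (\<kappa> j)" by metis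
    \<comment> \<open>For each \<open>k < K\<close> the sequence \<open>t\<close> is eventually in
      \<open>B k\<close>, hence outside \<open>A k\<close>, while \<open>t j\<close> lies in
      \<open>A (\<kappa> j)\<close>.\<close>
    have \<kappa>: "filterlim \<kappa> at_top sequentially"
      unfolding filterlim_at_top
    proof
      fix K
      have "\<forall>\<^sub>F j in sequentially. \<forall>k\<in>{..<K}. t j \<in> B k"
        using t(2) AB unfolding limitin_def by (intro eventually_ball_finite) auto
      then show "\<forall>\<^sub>F j in sequentially. K \<le> \<kappa> j"
      proof eventually_elim
        case (elim j)
        then show ?case using \<kappa>\<nu>(3)[of j] AB(5)[of "\<kappa> j"] by (meson disjoint_iff lessThan_iff not_le)
      qed
    qed
    have "\<exists>x. x \<in> G \<and> s (\<kappa> j) (\<nu> j) = \<pi> x" for j using \<kappa>\<nu>(2)[of j] topspace_Q by auto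
    then obtain x where x: "\<And>j. x j \<in> G" "\<And>j. s (\<kappa> j) (\<nu> j) = \<pi> (x j)" by metis
    \<comment> \<open>Divergence of \<open>\<kappa>\<close> makes the translating cosets themselves
      converge to the base point, as untranslating demands.\<close>
    have "limitin Q (\<lambda>j. \<pi> (z (\<kappa> j))) (\<pi> \<zero>) sequentially"
      using limz eventually_compose_filterlim[OF _ \<kappa>] unfolding limitin_def by blast
    moreover have "t = (\<lambda>j. \<pi> (z (\<kappa> j) \<oplus> x j))"
      using \<kappa>\<nu>(1) x image_coset z by auto
    ultimately have "limitin Q (\<lambda>j. \<pi> (x j)) (\<pi> \<zero>) sequentially"
      using limitin_untranslate[of "\<lambda>j. z (\<kappa> j)" x sequentially] t(2) z(1) x(1) by blast
    then have "limitin Q (\<lambda>j. s (\<kappa> j) (\<nu> j)) (\<pi> \<zero>) sequentially"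
      using x(2) by simp
    then show ?thesis using \<kappa> by blast
  qed
qed

text \<open>By homogeneity a countable base at \<open>\<pi> \<zero>\<close> suffices; left
  translation carries it to every other coset.\<close>

lemma first_countable_quotient:
  assumes FU: "frechet_urysohn Q" and "has_omega_omega_base Q"
  shows "first_countable Q"
proof -
  have p: "\<pi> \<zero> \<in> topspace Q" using topspace_Q zero_closed by blast
  obtain U :: "(nat \<Rightarrow> nat) \<Rightarrow> 'a set set" where
    U: "nbhd_base Q (\<pi> \<zero>) (range U)" and anti: "\<forall>\<alpha> \<beta>. \<alpha> \<le> \<beta> \<longrightarrow> U \<beta> \<subseteq> U \<alpha>"
    using assms(2)[unfolded has_omega_omega_base_def, rule_format, OF p] by (elim exE conjE)
  obtain \<B> where \<B>: "countable \<B>" "\<forall>V\<in>\<B>. openin Q V"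
    "\<And>W. openin Q W \<and> \<pi> \<zero> \<in> W \<Longrightarrow> \<exists>V\<in>\<B>. \<pi> \<zero> \<in> V \<and> V \<subseteq> W"
    using countable_base_at_if_omega_omega_base
      [OF FU alpha4_quotient[OF FU] p U anti] by (elim exE conjE) auto
  show ?thesis
    unfolding first_countable_def
  proof
    fix q assume "q \<in> topspace Q"
    then obtain x where x: "x \<in> G" "q = \<pi> x" using topspace_Q by blast
    have nx: "\<ominus> x \<in> G" using x neg_closed by blast
    \<comment> \<open>The translate of \<open>V\<close> by \<open>x\<close>, written as a preimage
      under the inverse translation so that continuity yields openness.\<close>
    define pre where "pre V = {c \<in> topspace Q. add (\<ominus> x) ` c \<in> V}" for V
    show "\<exists>\<B>. countable \<B> \<and> (\<forall>V\<in>\<B>. openin Q V) \<and>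
            (\<forall>W. openin Q W \<and> q \<in> W \<longrightarrow> (\<exists>V\<in>\<B>. q \<in> V \<and> V \<subseteq> W))"
    proof (intro exI[of _ "pre ` \<B>"] conjI allI impI ballI)
      show "countable (pre ` \<B>)" using \<B> by blast
      show "openin Q V" if "V \<in> pre ` \<B>" for V
        using that \<B>(2) openin_continuous_map_preimage[OF continuous_map_translation[OF nx]]
        unfolding pre_def by blast
      fix W assume W: "openin Q W \<and> q \<in> W"
      \<comment> \<open>Pulling \<open>W\<close> back along translation by \<open>x\<close> gives a
        neighbourhood of the base point in which to find \<open>V\<close>.\<close>
      have "openin Q {c \<in> topspace Q. add x ` c \<in> W}"
        using openin_continuous_map_preimage[OF continuous_map_translation[OF x(1)]] W by blast
      moreover have "add x ` \<pi> \<zero> = q" using image_coset x zero_closed zero_right by metis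
      ultimately obtain V where V: "V \<in> \<B>" "\<pi> \<zero> \<in> V" "V \<subseteq> {c \<in> topspace Q. add x ` c \<in> W}"
        using \<B>(3)[of "{c \<in> topspace Q. add x ` c \<in> W}"] W p by auto
      have "q \<in> pre V"
        unfolding pre_def using V x \<open>q \<in> topspace Q\<close> by (simp add: image_coset nx neg_left)
      moreover have "pre V \<subseteq> W"
      proof
        fix c assume c: "c \<in> pre V"
        then obtain a where a: "a \<in> G" "c = \<pi> a" unfolding pre_def topspace_Q by blast
        have "add (\<ominus> x) ` c = \<pi> (\<ominus> x \<oplus> a)" using a image_coset nx by blast
        then have "add x ` add (\<ominus> x) ` c = c"
          using image_coset[of x "\<ominus> x \<oplus> a"] add_neg_cancel a nx x add_closed by metis
        then show "c \<in> W" using c V(3) unfolding pre_def by force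
      qed
      ultimately show "\<exists>V\<in>pre ` \<B>. q \<in> V \<and> V \<subseteq> W" using V(1) by blast
    qed
  qed
qed

end

theorem theorem3p13:
  fixes T :: "'a topology" and G :: "'a set"
    and add :: "'a \<Rightarrow> 'a \<Rightarrow> 'a" and zero :: 'a and neg :: "'a \<Rightarrow> 'a"
    and gyr :: "'a \<Rightarrow> 'a \<Rightarrow> 'a \<Rightarrow> 'a"
    and \<U> :: "'a set set" and H :: "'a set"
  assumes "strongly_topological_gyrogroup T G add zero neg gyr \<U>"
    and "Hausdorff_space T"
    and "\<forall>U\<in>\<U>. symmetric_set neg U"
    and "admissible_subgyrogroup T G add zero neg gyr H"
    and "generated_from T add zero neg H \<U>"
    and "neutral_subgyrogroup T G add zero gyr H"
    and "frechet_urysohn (quotient_space T add H)"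
    and "has_omega_omega_base (quotient_space T add H)"
  shows "first_countable (quotient_space T add H)"
proof -
  \<comment> \<open>The sequence is taken from \<open>generated_from\<close>, which places every
    \<open>S n\<close> in \<open>\<U>\<close> and so makes it gyration invariant.\<close>
  obtain S where "admissible_sequence T add zero neg H S" "\<forall>n. S n \<in> \<U>"
    using assms(5) unfolding generated_from_def by blast
  then interpret neutral_admissible_quotient T G add zero neg gyr \<U> H S
    using assms(1,3,6)
    by (intro neutral_admissible_quotient.intro neutral_admissible_quotient_axioms.intro)
      (auto simp: neutral_subgyrogroup_def)
  show ?thesis
    using assms(7,8) by (rule first_countable_quotient)
qed

end
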